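(* Let $\mathcal T=(V,p)$ be a leafless locally countable directed forest. Then the following conditions are equivalent: (a) every bounded hyponormal weighted shift on $\mathcal T$ is power hyponormal; (b) if $S_\lambda$ is a bounded hyponormal weighted shift on $\mathcal T$, then $S_\lambda^2$ is hyponormal; (c) $\mathcal T$ is a forkless forest. Moreover, the conditions (a) and (b) remain equivalent if (in both of them) we restrict to proper weighted shifts.
   Context: A directed forest is a pair $\mathcal T=(V,p)$ where $V$ is a nonempty set and $p:V\to V$ is a function such that $p^n(v)=v$ with $n\ge 1$ implies $p(v)=v$. Roots: $\mathrm{root}(\mathcal T)=\{v\in V: p(v)=v\}$; $V^\circ=V\setminus\mathrm{root}(\mathcal T)$. The children of $v$ are the elements of $\mathrm{Chi}(v)=p^{-1}(v)\setminus\{v\}$; the degree of $v$ is the cardinality of $\mathrm{Chi}(v)$. The forest is leafless if $p(V)=V$, and locally countable if every vertex has degree at most $\aleph_0$. It is a forkless forest if every $v\in V^\circ$ has degree exactly one. $\ell^2(V)$ is the complex Hilbert space of square-summable functions $V\to\mathbb C$. A system of weights on $\mathcal T$ is $\lambda=\{\lambda_v\}_{v\in V}\subseteq\mathbb C$ with $\lambda_v=0$ for every root $v$. The weighted shift $S_\lambda$ on $\mathcal T$ is the operator in $\ell^2(V)$ given by $(S_\lambda f)(v)=\lambda_v f(p(v))$ with domain consisting of all $f\in\ell^2(V)$ for which this function is in $\ell^2(V)$. $S_\lambda$ is proper if $\{v:\lambda_v=0\}=\mathrm{root}(\mathcal T)$. A bounded operator $T$ on a complex Hilbert space is hyponormal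 if $T^*T-TT^*\ge 0$, and power hyponormal if $T^n$ is hyponormal for every $n\ge1$. *)

theory Defs
  imports "HOL-Analysis.Analysis"
begin

section \<open>Directed forests\<close>

definition directed_forest :: "'v set \<Rightarrow> ('v \<Rightarrow> 'v) \<Rightarrow> bool" where
  "directed_forest V p \<longleftrightarrow>
     V \<noteq> {} \<and> p \<in> V \<rightarrow> V \<and> (\<forall>v\<in>V. \<forall>n\<ge>1. (p ^^ n) v = v \<longrightarrow> p v = v)"

definition roots :: "'v set \<Rightarrow> ('v \<Rightarrow> 'v) \<Rightarrow> 'v set" where
  "roots V p = {v \<in> V. p v = v}"

definition Chi :: "'v set \<Rightarrow> ('v \<Rightarrow> 'v) \<Rightarrow> 'v \<Rightarrow> 'v set" where
  "Chi V p v = {u \<in> V. p u = v} - {v}"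

definition leafless :: "'v set \<Rightarrow> ('v \<Rightarrow> 'v) \<Rightarrow> bool" where
  "leafless V p \<longleftrightarrow> p ` V = V"

definition locally_countable :: "'v set \<Rightarrow> ('v \<Rightarrow> 'v) \<Rightarrow> bool" where
  "locally_countable V p \<longleftrightarrow> (\<forall>v\<in>V. countable (Chi V p v))"

text \<open>Roots are exempt: they may have any number of children.\<close>

definition forkless :: "'v set \<Rightarrow> ('v \<Rightarrow> 'v) \<Rightarrow> bool" where
  "forkless V p \<longleftrightarrow> (\<forall>v\<in>V - roots V p. card (Chi V p v) = 1)"

section \<open>The Hilbert space of square-summable functions\<close>

text \<open>A function on \<open>V\<close> is represented by its extension by zero to the whole type, so that
  equality in the space is equality of HOL functions.\<close>

definition ell2 :: "'v set \<Rightarrow> ('v \<Rightarrow> complex) set" where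
  "ell2 V = {f. (\<forall>v. v \<notin> V \<longrightarrow> f v = 0) \<and> (\<lambda>v. (cmod (f v))\<^sup>2) summable_on V}"

definition ell2_inner :: "'v set \<Rightarrow> ('v \<Rightarrow> complex) \<Rightarrow> ('v \<Rightarrow> complex) \<Rightarrow> complex" where
  "ell2_inner V f g = (\<Sum>\<^sub>\<infinity>v\<in>V. f v * cnj (g v))"

definition ell2_norm :: "'v set \<Rightarrow> ('v \<Rightarrow> complex) \<Rightarrow> real" where
  "ell2_norm V f = sqrt (\<Sum>\<^sub>\<infinity>v\<in>V. (cmod (f v))\<^sup>2)"

section \<open>Bounded operators\<close>

text \<open>Operators are HOL functions of which only the values on \<open>ell2 V\<close> matter.
  A bounded operator is everywhere defined on \<open>ell2 V\<close>.\<close>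

definition bounded_operator :: "'v set \<Rightarrow> (('v \<Rightarrow> complex) \<Rightarrow> ('v \<Rightarrow> complex)) \<Rightarrow> bool" where
  "bounded_operator V T \<longleftrightarrow>
     T \<in> ell2 V \<rightarrow> ell2 V \<and>
     (\<forall>f\<in>ell2 V. \<forall>g\<in>ell2 V. T (\<lambda>v. f v + g v) = (\<lambda>v. T f v + T g v)) \<and>
     (\<forall>c. \<forall>f\<in>ell2 V. T (\<lambda>v. c * f v) = (\<lambda>v. c * T f v)) \<and>
     (\<exists>C. \<forall>f\<in>ell2 V. ell2_norm V (T f) \<le> C * ell2_norm V f)"

text \<open>For a bounded operator \<open>T\<close> and \<open>g \<in> ell2 V\<close> the described vector exists and is unique
  (Riesz).\<close>

definition adjoint_op ::
    "'v set \<Rightarrow> (('v \<Rightarrow> complex) \<Rightarrow> ('v \<Rightarrow> complex)) \<Rightarrow> ('v \<Rightarrow> complex) \<Rightarrow> ('v \<Rightarrow> complex)" where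
  "adjoint_op V T g =
     (THE h. h \<in> ell2 V \<and> (\<forall>f\<in>ell2 V. ell2_inner V (T f) g = ell2_inner V f h))"

definition positive_op :: "'v set \<Rightarrow> (('v \<Rightarrow> complex) \<Rightarrow> ('v \<Rightarrow> complex)) \<Rightarrow> bool" where
  "positive_op V A \<longleftrightarrow> (\<forall>f\<in>ell2 V. ell2_inner V (A f) f \<in> \<real>\<^sub>\<ge>\<^sub>0)"

definition hyponormal :: "'v set \<Rightarrow> (('v \<Rightarrow> complex) \<Rightarrow> ('v \<Rightarrow> complex)) \<Rightarrow> bool" where
  "hyponormal V T \<longleftrightarrow>
     bounded_operator V T \<and>
     positive_op V (\<lambda>f v. adjoint_op V T (T f) v - T (adjoint_op V T f) v)"

definition power_hyponormal :: "'v set \<Rightarrow> (('v \<Rightarrow> complex) \<Rightarrow> ('v \<Rightarrow> complex)) \<Rightarrow> bool" where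
  "power_hyponormal V T \<longleftrightarrow> (\<forall>n\<ge>1. hyponormal V (T ^^ n))"

section \<open>Weighted shifts\<close>

definition weight_system :: "'v set \<Rightarrow> ('v \<Rightarrow> 'v) \<Rightarrow> ('v \<Rightarrow> complex) \<Rightarrow> bool" where
  "weight_system V p l \<longleftrightarrow> (\<forall>v\<in>roots V p. l v = 0)"

definition weighted_shift ::
    "'v set \<Rightarrow> ('v \<Rightarrow> 'v) \<Rightarrow> ('v \<Rightarrow> complex) \<Rightarrow> ('v \<Rightarrow> complex) \<Rightarrow> ('v \<Rightarrow> complex)" where
  "weighted_shift V p l f = (\<lambda>v. if v \<in> V then l v * f (p v) else 0)"

definition weighted_shift_dom ::
    "'v set \<Rightarrow> ('v \<Rightarrow> 'v) \<Rightarrow> ('v \<Rightarrow> complex) \<Rightarrow> ('v \<Rightarrow> complex) set" where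
  "weighted_shift_dom V p l = {f \<in> ell2 V. weighted_shift V p l f \<in> ell2 V}"

definition bounded_weighted_shift :: "'v set \<Rightarrow> ('v \<Rightarrow> 'v) \<Rightarrow> ('v \<Rightarrow> complex) \<Rightarrow> bool" where
  "bounded_weighted_shift V p l \<longleftrightarrow>
     weight_system V p l \<and> weighted_shift_dom V p l = ell2 V \<and>
     bounded_operator V (weighted_shift V p l)"

definition proper_weights :: "'v set \<Rightarrow> ('v \<Rightarrow> 'v) \<Rightarrow> ('v \<Rightarrow> complex) \<Rightarrow> bool" where
  "proper_weights V p l \<longleftrightarrow> {v \<in> V. l v = 0} = roots V p"

end

theory Submission
  imports Defs
begin

text \<open>Write \<open>W v = \<parallel>S e\<^sub>v\<parallel>\<^sup>2\<close>, the sum of \<open>|\<lambda>\<^sub>y|\<^sup>2\<close> over the preimages \<open>y\<close> of \<open>v\<close>. Both \<open>\<parallel>S f\<parallel>\<^sup>2\<close> and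
  \<open>\<parallel>S\<^sup>* f\<parallel>\<^sup>2\<close> split as sums over the fibres of \<open>p\<close>, and the Cauchy--Schwarz inequality on each fibre
  shows that a bounded \<open>S\<close> is hyponormal iff \<open>W\<close> does not vanish where \<open>\<lambda>\<close> does not, and the sum of
  \<open>|\<lambda>\<^sub>v|\<^sup>2 / W v\<close> over each fibre is at most \<open>1\<close>. This needs no assumption on the map \<open>p\<close>, hence applies
  to \<open>S\<^sup>n\<close>, which is a weighted shift over \<open>p\<^sup>n\<close>. The criterion passes to all powers if there are no
  forks, while a fork at a non-root admits proper weights for which it holds for \<open>S\<close> but not for
  \<open>S\<^sup>2\<close>; the equivalence for proper shifts follows from this as well.\<close>

section \<open>Square-summable functions\<close>

lemma ell2_finite_support:
  assumes "finite F" "F \<subseteq> V" "\<And>v. v \<notin> F \<Longrightarrow> f v = 0"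
  shows "f \<in> ell2 V" and "(ell2_norm V f)\<^sup>2 = (\<Sum>v\<in>F. (cmod (f v))\<^sup>2)"
proof -
  have "((\<lambda>v. (cmod (f v))\<^sup>2) has_sum (\<Sum>v\<in>F. (cmod (f v))\<^sup>2)) V"
    by (rule has_sum_finite_neutralI) (use assms in auto)
  then show "f \<in> ell2 V" "(ell2_norm V f)\<^sup>2 = (\<Sum>v\<in>F. (cmod (f v))\<^sup>2)"
    using assms by (auto simp: ell2_def ell2_norm_def has_sum_imp_summable infsumI sum_nonneg)
qed

lemma ell2_norm_sq: "(ell2_norm V f)\<^sup>2 = (\<Sum>\<^sub>\<infinity>v\<in>V. (cmod (f v))\<^sup>2)"
  by (simp add: ell2_norm_def infsum_nonneg)

lemma ell2_norm_nonneg [simp]: "0 \<le> ell2_norm V f"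
  by (simp add: ell2_norm_def infsum_nonneg)

lemma ell2_outside: "f \<in> ell2 V \<Longrightarrow> v \<notin> V \<Longrightarrow> f v = 0"
  by (simp add: ell2_def)

lemma ell2_summable: "f \<in> ell2 V \<Longrightarrow> (\<lambda>v. (cmod (f v))\<^sup>2) summable_on V"
  by (simp add: ell2_def)

lemma ell2_mult_summable:
  assumes "f \<in> ell2 V" "g \<in> ell2 V"
  shows "(\<lambda>v. f v * cnj (g v)) summable_on V"
proof -
  have "(\<lambda>v. norm (f v * cnj (g v))) summable_on V"
    by (rule abs_summable_product)
       (use assms[THEN ell2_summable] in \<open>simp_all add: norm_mult power2_eq_square\<close>)
  then show ?thesis
    by (rule abs_summable_summable)
qed

lemma ell2_inner_self: "ell2_inner V f f = of_real ((ell2_norm V f)\<^sup>2)"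
  if "f \<in> ell2 V"
proof -
  have "ell2_inner V f f = (\<Sum>\<^sub>\<infinity>v\<in>V. of_real ((cmod (f v))\<^sup>2))"
    unfolding ell2_inner_def by (rule infsum_cong) (metis complex_norm_square)
  also have "\<dots> = of_real ((ell2_norm V f)\<^sup>2)"
    unfolding ell2_norm_sq
    by (intro infsumI has_sum_of_real has_sum_infsum ell2_summable that)
  finally show ?thesis .
qed

lemma ell2_inner_cnj: "ell2_inner V g f = cnj (ell2_inner V f g)"
  unfolding ell2_inner_def by (simp flip: infsum_cnj add: mult.commute)

lemma ell2_inner_diff:
  assumes "f \<in> ell2 V" "g \<in> ell2 V" "h \<in> ell2 V"
  shows "ell2_inner V (\<lambda>v. f v - g v) h = ell2_inner V f h - ell2_inner V g h"
proof -
  have "ell2_inner V (\<lambda>v. f v - g v) h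
      = (\<Sum>\<^sub>\<infinity>v\<in>V. f v * cnj (h v) + - (g v * cnj (h v)))"
    by (simp add: ell2_inner_def left_diff_distrib)
  also have "\<dots> = ell2_inner V f h + (\<Sum>\<^sub>\<infinity>v\<in>V. - (g v * cnj (h v)))"
    unfolding ell2_inner_def
    by (intro infsum_add ell2_mult_summable summable_on_uminus[THEN iffD2] assms)
  finally show ?thesis
    by (simp add: ell2_inner_def infsum_uminus)
qed

text \<open>Cauchy-Schwarz for the factors \<open>a / sqrt w\<close> and \<open>sqrt w * b\<close>.
  It is used with \<open>w = 1\<close> to build the adjoint and with \<open>w = W\<close>,
  \<open>K = 1\<close> for hyponormality. Bounding finite partial sums by \<open>K\<close> avoids a
  summability condition on the first factor.\<close>

lemma weighted_Cauchy_Schwarz: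
  fixes a b :: "'a \<Rightarrow> complex" and w :: "'a \<Rightarrow> real"
  assumes w: "\<And>v. v \<in> A \<Longrightarrow> 0 \<le> w v"
    and nz: "\<And>v. v \<in> A \<Longrightarrow> a v \<noteq> 0 \<Longrightarrow> w v \<noteq> 0"
    and K: "\<And>F. finite F \<Longrightarrow> F \<subseteq> A \<Longrightarrow> (\<Sum>v\<in>F. (cmod (a v))\<^sup>2 / w v) \<le> K"
    and sm: "(\<lambda>v. w v * (cmod (b v))\<^sup>2) summable_on A"
  shows "(\<lambda>v. a v * b v) summable_on A"
    and "(cmod (\<Sum>\<^sub>\<infinity>v\<in>A. a v * b v))\<^sup>2 \<le> K * (\<Sum>\<^sub>\<infinity>v\<in>A. w v * (cmod (b v))\<^sup>2)"
proof -
  define B where "B = (\<Sum>\<^sub>\<infinity>v\<in>A. w v * (cmod (b v))\<^sup>2)"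
  have K0: "0 \<le> K"
    using K[of "{}"] by simp
  have B0: "0 \<le> B"
    unfolding B_def by (rule infsum_nonneg) (simp add: w)
  have fin: "(\<Sum>v\<in>F. cmod (a v * b v)) \<le> sqrt (K * B)" if F: "finite F" "F \<subseteq> A" for F
  proof -
    \<comment> \<open>Where \<open>w v = 0\<close>, \<open>nz\<close> forces \<open>a v = 0\<close>,
      so inserting the factor and its inverse changes nothing.\<close>
    have "(\<Sum>v\<in>F. cmod (a v * b v)) = (\<Sum>v\<in>F. (cmod (a v) / sqrt (w v)) * (sqrt (w v) * cmod (b v)))"
      using F nz by (intro sum.cong) (auto simp: norm_mult)
    then have "(\<Sum>v\<in>F. cmod (a v * b v))\<^sup>2
        \<le> (\<Sum>v\<in>F. (cmod (a v) / sqrt (w v))\<^sup>2) * (\<Sum>v\<in>F. (sqrt (w v) * cmod (b v))\<^sup>2)"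
      by (metis Cauchy_Schwarz_ineq_sum)
    also have "\<dots> = (\<Sum>v\<in>F. (cmod (a v))\<^sup>2 / w v) * (\<Sum>v\<in>F. w v * (cmod (b v))\<^sup>2)"
      using F w by (intro arg_cong2[where f = "(*)"] sum.cong)
        (auto simp: power_divide power_mult_distrib)
    also have "\<dots> \<le> K * B"
      unfolding B_def using F K K0 w sm
      by (intro mult_mono finite_sum_le_infsum) (auto intro!: sum_nonneg)
    finally show ?thesis
      by (rule real_le_rsqrt)
  qed
  have abs: "(\<lambda>v. norm (a v * b v)) summable_on A"
    by (rule nonneg_bdd_above_summable_on) (auto intro!: bdd_aboveI2[where M = "sqrt (K * B)"] fin)
  then show "(\<lambda>v. a v * b v) summable_on A"
    by (rule abs_summable_summable)
  have "cmod (\<Sum>\<^sub>\<infinity>v\<in>A. a v * b v) \<le> (\<Sum>\<^sub>\<infinity>v\<in>A. cmod (a v * b v))"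
    using abs by (rule norm_infsum_bound)
  also have "\<dots> \<le> sqrt (K * B)"
    by (rule infsum_le_finite_sums[OF abs fin])
  finally have "(cmod (\<Sum>\<^sub>\<infinity>v\<in>A. a v * b v))\<^sup>2 \<le> (sqrt (K * B))\<^sup>2"
    by (rule power_mono) simp
  then show "(cmod (\<Sum>\<^sub>\<infinity>v\<in>A. a v * b v))\<^sup>2 \<le> K * (\<Sum>\<^sub>\<infinity>v\<in>A. w v * (cmod (b v))\<^sup>2)"
    using K0 B0 by (simp add: B_def)
qed

section \<open>Weighted shifts along the fibres of a map\<close>

text \<open>In contrast to \<open>Chi\<close>, a root lies in its own fibre. Thus the fibres
  partition \<open>V\<close> for any self-map, in particular for the iterates of
  \<open>p\<close>.\<close>

definition fibre :: "'v set \<Rightarrow> ('v \<Rightarrow> 'v) \<Rightarrow> 'v \<Rightarrow> 'v set" where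
  "fibre V p u = {v \<in> V. p v = u}"

text \<open>A non-summable fibre would get the default value 0, so summability is established
  alongside bounds on this number.\<close>

definition fibre_weight :: "'v set \<Rightarrow> ('v \<Rightarrow> 'v) \<Rightarrow> ('v \<Rightarrow> complex) \<Rightarrow> 'v \<Rightarrow> real" where
  "fibre_weight V p l u = (\<Sum>\<^sub>\<infinity>v\<in>fibre V p u. (cmod (l v))\<^sup>2)"

lemma fibre_subset: "fibre V p u \<subseteq> V"
  by (auto simp: fibre_def)

lemma fibre_weight_nonneg [simp]: "0 \<le> fibre_weight V p l u"
  by (simp add: fibre_weight_def infsum_nonneg)

lemma bij_betw_fibres: "bij_betw snd (Sigma U (fibre V p)) {v \<in> V. p v \<in> U}"
  by (rule bij_betwI[where g = "\<lambda>v. (p v, v)"]) (auto simp: fibre_def)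

lemma has_sum_fibresD:
  fixes f :: "'v \<Rightarrow> 'a :: {topological_comm_monoid_add, t3_space}"
  assumes "(f has_sum s) {v \<in> V. p v \<in> U}"
    and "\<And>u. u \<in> U \<Longrightarrow> (f has_sum g u) (fibre V p u)"
  shows "(g has_sum s) U"
proof -
  have "((\<lambda>x. f (snd x)) has_sum s) (Sigma U (fibre V p))"
    using assms(1) has_sum_reindex_bij_betw[OF bij_betw_fibres] by blast
  then show ?thesis
    by (rule has_sum_SigmaD) (simp add: assms(2))
qed

text \<open>Converse of the previous regrouping; nonnegativity makes the iterated sum control the
  sum over the union.\<close>

lemma has_sum_fibresI:
  fixes f :: "'v \<Rightarrow> real"
  assumes f: "\<And>u. u \<in> U \<Longrightarrow> (f has_sum g u) (fibre V p u)"
    and g: "(g has_sum s) U" and nn: "\<And>v. v \<in> V \<Longrightarrow> p v \<in> U \<Longrightarrow> 0 \<le> f v"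
  shows "(f has_sum s) {v \<in> V. p v \<in> U}"
proof -
  have "((\<lambda>x. f (snd x)) has_sum s) (Sigma U (fibre V p))"
  proof (rule has_sum_SigmaI)
    show "(\<lambda>x. f (snd x)) summable_on Sigma U (fibre V p)"
      by (rule summable_on_SigmaI[where g = g])
         (use f g nn in \<open>auto simp: fibre_def has_sum_imp_summable\<close>)
  qed (use f g in auto)
  then show ?thesis
    using has_sum_reindex_bij_betw[OF bij_betw_fibres] by blast
qed

text \<open>On the fibre over \<open>u\<close> the image is \<open>l v * f u\<close>, so its squared
  norm is the sum of \<open>fibre_weight V p l u * (cmod (f u))\<^sup>2\<close>.\<close>

lemma weighted_shift_ell2:
  assumes p: "p \<in> V \<rightarrow> V"
    and sm: "\<And>u. u \<in> V \<Longrightarrow> (\<lambda>v. (cmod (l v))\<^sup>2) summable_on fibre V p u"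
    and C: "\<And>u. u \<in> V \<Longrightarrow> fibre_weight V p l u \<le> C"
    and f: "f \<in> ell2 V"
  shows "weighted_shift V p l f \<in> ell2 V"
    and "ell2_norm V (weighted_shift V p l f) \<le> sqrt C * ell2_norm V f"
proof -
  have Vp: "{v \<in> V. p v \<in> V} = V"
    using p by auto
  have dom: "(\<lambda>u. C * (cmod (f u))\<^sup>2) summable_on V"
    using ell2_summable[OF f] by (rule summable_on_cmult_right)
  have le: "fibre_weight V p l u * (cmod (f u))\<^sup>2 \<le> C * (cmod (f u))\<^sup>2" if "u \<in> V" for u
    using C[OF that] by (rule mult_right_mono) simp
  have smW: "(\<lambda>u. fibre_weight V p l u * (cmod (f u))\<^sup>2) summable_on V"
    by (rule summable_on_comparison_test[OF dom]) (use le in auto)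
  have hs: "((\<lambda>v. (cmod (weighted_shift V p l f v))\<^sup>2) has_sum
      (\<Sum>\<^sub>\<infinity>u\<in>V. fibre_weight V p l u * (cmod (f u))\<^sup>2)) {v \<in> V. p v \<in> V}"
  proof (rule has_sum_fibresI)
    fix u assume u: "u \<in> V"
    have "((\<lambda>v. (cmod (l v))\<^sup>2 * (cmod (f u))\<^sup>2) has_sum fibre_weight V p l u * (cmod (f u))\<^sup>2)
      (fibre V p u)"
      unfolding fibre_weight_def by (intro has_sum_cmult_left has_sum_infsum sm u)
    then show "((\<lambda>v. (cmod (weighted_shift V p l f v))\<^sup>2) has_sum
        fibre_weight V p l u * (cmod (f u))\<^sup>2) (fibre V p u)"
      by (rule has_sum_cong[THEN iffD1, rotated])
         (auto simp: fibre_def weighted_shift_def norm_mult power_mult_distrib)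
  qed (use smW in auto)
  then show "weighted_shift V p l f \<in> ell2 V"
    by (auto simp: Vp ell2_def weighted_shift_def has_sum_imp_summable)
  have "(ell2_norm V (weighted_shift V p l f))\<^sup>2
      = (\<Sum>\<^sub>\<infinity>u\<in>V. fibre_weight V p l u * (cmod (f u))\<^sup>2)"
    using hs by (simp add: ell2_norm_sq Vp infsumI)
  also have "\<dots> \<le> C * (ell2_norm V f)\<^sup>2"
    unfolding ell2_norm_sq infsum_cmult_right'[symmetric]
    by (rule infsum_mono[OF smW dom le])
  finally have "ell2_norm V (weighted_shift V p l f) \<le> sqrt (C * (ell2_norm V f)\<^sup>2)"
    by (rule real_le_rsqrt)
  then show "ell2_norm V (weighted_shift V p l f) \<le> sqrt C * ell2_norm V f"
    by (simp add: real_sqrt_mult)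
qed

lemma bounded_operator_weighted_shiftI:
  assumes "p \<in> V \<rightarrow> V"
    and "\<And>u. u \<in> V \<Longrightarrow> (\<lambda>v. (cmod (l v))\<^sup>2) summable_on fibre V p u"
    and "\<And>u. u \<in> V \<Longrightarrow> fibre_weight V p l u \<le> C"
  shows "bounded_operator V (weighted_shift V p l)"
  unfolding bounded_operator_def
  using weighted_shift_ell2[OF assms]
  by (auto simp: weighted_shift_def fun_eq_iff algebra_simps)

text \<open>Both assumptions survive passing to \<open>p ^^ n\<close> with product weights, where
  the locale is interpreted again.\<close>

locale bounded_shift =
  fixes V :: "'v set" and p :: "'v \<Rightarrow> 'v" and l :: "'v \<Rightarrow> complex"
  assumes p_in: "p \<in> V \<rightarrow> V"
    and bounded: "bounded_operator V (weighted_shift V p l)"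
begin

abbreviation "S \<equiv> weighted_shift V p l"
abbreviation "W \<equiv> fibre_weight V p l"

lemma preimage_V: "{v \<in> V. p v \<in> V} = V"
  using p_in by auto

lemma S_ell2: "f \<in> ell2 V \<Longrightarrow> S f \<in> ell2 V"
  using bounded by (auto simp: bounded_operator_def)

text \<open>The image of the point mass at \<open>u\<close> agrees with \<open>l\<close> on the
  fibre over \<open>u\<close>.\<close>

lemma fibre_summable:
  assumes u: "u \<in> V"
  shows "(\<lambda>v. (cmod (l v))\<^sup>2) summable_on fibre V p u"
proof -
  define e :: "'v \<Rightarrow> complex" where "e = (\<lambda>v. if v = u then 1 else 0)"
  have "e \<in> ell2 V"
    by (rule ell2_finite_support[of "{u}"]) (use u in \<open>auto simp: e_def\<close>)
  then have "(\<lambda>v. (cmod (S e v))\<^sup>2) summable_on fibre V p u"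
    by (intro summable_on_subset_banach[OF ell2_summable[OF S_ell2] fibre_subset])
  then show ?thesis
    by (rule summable_on_cong[THEN iffD1, rotated])
       (auto simp: fibre_def weighted_shift_def e_def)
qed

lemma S_norm:
  assumes f: "f \<in> ell2 V"
  shows "((\<lambda>u. W u * (cmod (f u))\<^sup>2) has_sum (ell2_norm V (S f))\<^sup>2) V"
proof (rule has_sum_fibresD[where p = p and V = V])
  show "((\<lambda>v. (cmod (S f v))\<^sup>2) has_sum (ell2_norm V (S f))\<^sup>2) {v \<in> V. p v \<in> V}"
    unfolding preimage_V ell2_norm_sq by (intro has_sum_infsum ell2_summable S_ell2 f)
next
  fix u assume u: "u \<in> V"
  have "((\<lambda>v. (cmod (l v))\<^sup>2 * (cmod (f u))\<^sup>2) has_sum W u * (cmod (f u))\<^sup>2) (fibre V p u)"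
    unfolding fibre_weight_def by (intro has_sum_cmult_left has_sum_infsum fibre_summable u)
  then show "((\<lambda>v. (cmod (S f v))\<^sup>2) has_sum W u * (cmod (f u))\<^sup>2) (fibre V p u)"
    by (rule has_sum_cong[THEN iffD1, rotated])
       (auto simp: fibre_def weighted_shift_def norm_mult power_mult_distrib)
qed

text \<open>Testing the operator bound on point masses works, since \<open>W u\<close> is the
  squared norm of the image of the point mass at \<open>u\<close>.\<close>

lemma fibre_weight_bounded:
  obtains K where "0 \<le> K" "\<And>u. u \<in> V \<Longrightarrow> W u \<le> K"
proof -
  obtain C where C: "\<And>f. f \<in> ell2 V \<Longrightarrow> ell2_norm V (S f) \<le> C * ell2_norm V f"
    using bounded unfolding bounded_operator_def by blast
  have "W u \<le> C\<^sup>2" if u: "u \<in> V" for u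
  proof -
    define e :: "'v \<Rightarrow> complex" where "e = (\<lambda>v. if v = u then 1 else 0)"
    have e: "e \<in> ell2 V" "(ell2_norm V e)\<^sup>2 = 1"
      using ell2_finite_support[of "{u}" V e] u by (auto simp: e_def)
    have "((\<lambda>v. W v * (cmod (e v))\<^sup>2) has_sum W u) V"
      by (rule has_sum_finite_neutralI[of "{u}"]) (use u in \<open>auto simp: e_def\<close>)
    with S_norm[OF e(1)] have "W u = (ell2_norm V (S e))\<^sup>2"
      by (metis has_sum_unique)
    also have "\<dots> \<le> (C * ell2_norm V e)\<^sup>2"
      by (rule power_mono[OF C[OF e(1)]]) simp
    finally show ?thesis
      using e(2) by (simp add: power_mult_distrib)
  qed
  then show ?thesis
    by (rule that[OF zero_le_power2])
qed

section \<open>The adjoint of a bounded shift\<close>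

definition adj :: "('v \<Rightarrow> complex) \<Rightarrow> 'v \<Rightarrow> complex" where
  "adj g u = (if u \<in> V then \<Sum>\<^sub>\<infinity>v\<in>fibre V p u. cnj (l v) * g v else 0)"

lemma summable_fibre_ell2:
  assumes "g \<in> ell2 V"
  shows "(\<lambda>v. (cmod (g v))\<^sup>2) summable_on fibre V p u"
  by (rule summable_on_subset_banach[OF ell2_summable[OF assms] fibre_subset])

text \<open>Cauchy-Schwarz with constant weight 1 on a single fibre; these facts make the infinite
  sum in \<open>adj\<close> meaningful.\<close>

lemma
  assumes u: "u \<in> V" and g: "g \<in> ell2 V"
  shows adj_summable: "(\<lambda>v. cnj (l v) * g v) summable_on fibre V p u"
    and adj_bound: "(cmod (adj g u))\<^sup>2 \<le> W u * (\<Sum>\<^sub>\<infinity>v\<in>fibre V p u. (cmod (g v))\<^sup>2)"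
proof -
  have K: "(\<Sum>v\<in>F. (cmod (cnj (l v)))\<^sup>2 / 1) \<le> W u" if "finite F" "F \<subseteq> fibre V p u" for F
    using that fibre_summable[OF u] unfolding fibre_weight_def
    by (simp add: finite_sum_le_infsum)
  have "(\<lambda>v. 1 * (cmod (g v))\<^sup>2) summable_on fibre V p u"
    using summable_fibre_ell2[OF g] by simp
  note CS = weighted_Cauchy_Schwarz[where w = "\<lambda>_. 1" and a = "\<lambda>v. cnj (l v)", OF _ _ K this]
  show "(\<lambda>v. cnj (l v) * g v) summable_on fibre V p u"
    by (rule CS(1)) auto
  show "(cmod (adj g u))\<^sup>2 \<le> W u * (\<Sum>\<^sub>\<infinity>v\<in>fibre V p u. (cmod (g v))\<^sup>2)"
    using CS(2) u by (simp add: adj_def)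
qed

lemma adj_ell2:
  assumes g: "g \<in> ell2 V"
  shows "adj g \<in> ell2 V"
proof -
  obtain K where K: "0 \<le> K" "\<And>u. u \<in> V \<Longrightarrow> W u \<le> K"
    by (rule fibre_weight_bounded) blast
  let ?G = "\<lambda>u. \<Sum>\<^sub>\<infinity>v\<in>fibre V p u. (cmod (g v))\<^sup>2"
  have "(?G has_sum (\<Sum>\<^sub>\<infinity>v\<in>V. (cmod (g v))\<^sup>2)) V"
  proof (rule has_sum_fibresD[where p = p and V = V])
    show "((\<lambda>v. (cmod (g v))\<^sup>2) has_sum (\<Sum>\<^sub>\<infinity>v\<in>V. (cmod (g v))\<^sup>2)) {v \<in> V. p v \<in> V}"
      unfolding preimage_V by (intro has_sum_infsum ell2_summable g)
  qed (intro has_sum_infsum summable_fibre_ell2 g)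
  then have "(\<lambda>u. K * ?G u) summable_on V"
    by (intro summable_on_cmult_right has_sum_imp_summable)
  moreover have "(cmod (adj g u))\<^sup>2 \<le> K * ?G u" if "u \<in> V" for u
    by (rule order_trans[OF adj_bound[OF that g]])
       (intro mult_right_mono K that infsum_nonneg, simp)
  ultimately have "(\<lambda>u. (cmod (adj g u))\<^sup>2) summable_on V"
    by (rule summable_on_comparison_test) auto
  then show ?thesis
    by (simp add: ell2_def adj_def)
qed

lemma adj_inner:
  assumes f: "f \<in> ell2 V" and g: "g \<in> ell2 V"
  shows "ell2_inner V (S f) g = ell2_inner V f (adj g)"
proof -
  have "((\<lambda>u. f u * cnj (adj g u)) has_sum ell2_inner V (S f) g) V"
  proof (rule has_sum_fibresD[where p = p and V = V])
    show "((\<lambda>v. S f v * cnj (g v)) has_sum ell2_inner V (S f) g) {v \<in> V. p v \<in> V}"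
      unfolding preimage_V ell2_inner_def by (intro has_sum_infsum ell2_mult_summable S_ell2 f g)
  next
    fix u assume u: "u \<in> V"
    have "((\<lambda>v. cnj (cnj (l v) * g v)) has_sum cnj (adj g u)) (fibre V p u)"
      unfolding has_sum_cnj_iff using has_sum_infsum[OF adj_summable[OF u g]] u by (simp add: adj_def)
    then have "((\<lambda>v. f u * cnj (cnj (l v) * g v)) has_sum f u * cnj (adj g u)) (fibre V p u)"
      by (rule has_sum_cmult_right)
    then show "((\<lambda>v. S f v * cnj (g v)) has_sum f u * cnj (adj g u)) (fibre V p u)"
      by (rule has_sum_cong[THEN iffD1, rotated]) (auto simp: fibre_def weighted_shift_def)
  qed
  then show ?thesis
    by (simp add: ell2_inner_def infsumI)
qed

text \<open>Uniqueness follows by pairing with point masses, which reads off the conjugates of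
  single coordinates.\<close>

lemma adjoint_op_S:
  assumes g: "g \<in> ell2 V"
  shows "adjoint_op V S g = adj g"
  unfolding adjoint_op_def
proof (rule the_equality)
  show "adj g \<in> ell2 V \<and> (\<forall>f\<in>ell2 V. ell2_inner V (S f) g = ell2_inner V f (adj g))"
    using adj_ell2 adj_inner g by blast
next
  fix h assume h: "h \<in> ell2 V \<and> (\<forall>f\<in>ell2 V. ell2_inner V (S f) g = ell2_inner V f h)"
  show "h = adj g"
  proof
    fix u
    show "h u = adj g u"
    proof (cases "u \<in> V")
      case True
      define e :: "'v \<Rightarrow> complex" where "e = (\<lambda>v. if v = u then 1 else 0)"
      have e: "e \<in> ell2 V"
        by (rule ell2_finite_support[of "{u}"]) (use True in \<open>auto simp: e_def\<close>)
      have ip: "ell2_inner V e k = cnj (k u)" for k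
        unfolding ell2_inner_def
        by (rule infsumI, rule has_sum_finite_neutralI[of "{u}"])
           (use True in \<open>auto simp: e_def\<close>)
      have "ell2_inner V e h = ell2_inner V e (adj g)"
        using h e adj_inner g by metis
      then show ?thesis
        by (simp add: ip)
    next
      case False
      then show ?thesis
        using h adj_ell2[OF g] by (metis ell2_outside)
    qed
  qed
qed

text \<open>The quadratic form of the self-commutator at \<open>f\<close> is the difference of the
  squared norms of \<open>S f\<close> and \<open>adj f\<close>.\<close>

lemma hyponormal_iff_norm:
  "hyponormal V S \<longleftrightarrow> (\<forall>f\<in>ell2 V. ell2_norm V (adj f) \<le> ell2_norm V (S f))"
proof -
  have "ell2_inner V (\<lambda>v. adjoint_op V S (S f) v - S (adjoint_op V S f) v) f
      = of_real ((ell2_norm V (S f))\<^sup>2 - (ell2_norm V (adj f))\<^sup>2)" if f: "f \<in> ell2 V" for f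
  proof -
    have Sf: "S f \<in> ell2 V" and af: "adj f \<in> ell2 V"
      using f by (auto intro: S_ell2 adj_ell2)
    have "ell2_inner V (\<lambda>v. adj (S f) v - S (adj f) v) f
        = ell2_inner V (adj (S f)) f - ell2_inner V (S (adj f)) f"
      by (intro ell2_inner_diff adj_ell2 S_ell2 Sf af f)
    also have "ell2_inner V (adj (S f)) f = cnj (ell2_inner V (S f) (S f))"
      by (simp add: adj_inner[OF f Sf] ell2_inner_cnj[of V "adj (S f)"])
    also have "ell2_inner V (S (adj f)) f = ell2_inner V (adj f) (adj f)"
      by (rule adj_inner[OF af f])
    finally show ?thesis
      by (simp add: adjoint_op_S[OF f] adjoint_op_S[OF Sf] ell2_inner_self Sf af)
  qed
  then show ?thesis
    unfolding hyponormal_def positive_op_def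
    by (auto simp: bounded complex_nonneg_Reals_iff power2_le_iff_abs_le
        simp del: of_real_diff of_real_power)
qed

section \<open>The hyponormality criterion\<close>

text \<open>The norm inequality is tested on a vector living in one fibre, keeping only the
  coordinate \<open>u\<close> of \<open>adj f\<close>.\<close>

lemma hyponormal_finite_support:
  assumes H: "hyponormal V S"
    and u: "u \<in> V" and F: "finite F" "F \<subseteq> fibre V p u" and f0: "\<And>v. v \<notin> F \<Longrightarrow> f v = 0"
  shows "(cmod (\<Sum>v\<in>F. cnj (l v) * f v))\<^sup>2 \<le> (\<Sum>v\<in>F. W v * (cmod (f v))\<^sup>2)"
proof -
  have FV: "F \<subseteq> V"
    using F(2) fibre_subset by (rule subset_trans)
  have f: "f \<in> ell2 V"
    by (rule ell2_finite_support(1)[of F]) (use F FV f0 in auto)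
  have "((\<lambda>v. cnj (l v) * f v) has_sum (\<Sum>v\<in>F. cnj (l v) * f v)) (fibre V p u)"
    by (rule has_sum_finite_neutralI[OF F _ refl]) (simp add: f0)
  then have *: "adj f u = (\<Sum>v\<in>F. cnj (l v) * f v)"
    using u by (simp add: adj_def infsumI)
  have "(cmod (adj f u))\<^sup>2 \<le> (ell2_norm V (adj f))\<^sup>2"
    using finite_sum_le_infsum[OF ell2_summable[OF adj_ell2[OF f]], of "{u}"] u
    by (simp add: ell2_norm_sq)
  also have "\<dots> \<le> (ell2_norm V (S f))\<^sup>2"
    using H f by (simp add: hyponormal_iff_norm power_mono)
  also have "(ell2_norm V (S f))\<^sup>2 = (\<Sum>v\<in>F. W v * (cmod (f v))\<^sup>2)"
  proof (rule has_sum_unique[OF S_norm[OF f]])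
    show "((\<lambda>v. W v * (cmod (f v))\<^sup>2) has_sum (\<Sum>v\<in>F. W v * (cmod (f v))\<^sup>2)) V"
      by (rule has_sum_finite_neutralI[OF F(1) FV _ refl]) (simp add: f0)
  qed
  finally show ?thesis
    unfolding * .
qed

lemma hyponormal_weight_nonzero:
  assumes H: "hyponormal V S" and v: "v \<in> V" "l v \<noteq> 0"
  shows "W v \<noteq> 0"
proof -
  have "p v \<in> V" "{v} \<subseteq> fibre V p (p v)"
    using v p_in by (auto simp: fibre_def)
  from hyponormal_finite_support[OF H this(1) _ this(2), of "\<lambda>u. if u = v then 1 else 0"]
  have "(cmod (l v))\<^sup>2 \<le> W v"
    by simp
  then show ?thesis
    using v(2) by auto
qed

lemma hyponormal_sum_le_1:
  assumes H: "hyponormal V S" and u: "u \<in> V" and F: "finite F" "F \<subseteq> fibre V p u"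
  shows "(\<Sum>v\<in>F. (cmod (l v))\<^sup>2 / W v) \<le> 1"
proof -
  \<comment> \<open>This is the equality case of the weighted Cauchy-Schwarz inequality: both sides
    of the test become powers of the same sum \<open>s\<close>. Terms with \<open>W v = 0\<close>
    vanish by the division convention.\<close>
  define f where "f v = (if v \<in> F then l v / of_real (W v) else 0)" for v
  define s where "s = (\<Sum>v\<in>F. (cmod (l v))\<^sup>2 / W v)"
  have "cnj (l v) * f v = of_real ((cmod (l v))\<^sup>2 / W v)" if "v \<in> F" for v
    using that complex_norm_square[of "l v"] by (simp add: f_def mult.commute)
  then have 1: "(\<Sum>v\<in>F. cnj (l v) * f v) = of_real s"
    unfolding s_def of_real_sum by (intro sum.cong) auto
  have "W v * (cmod (f v))\<^sup>2 = (cmod (l v))\<^sup>2 / W v" if "v \<in> F" for v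
    using that by (simp add: f_def norm_divide power_divide) (simp add: power2_eq_square)
  then have 2: "(\<Sum>v\<in>F. W v * (cmod (f v))\<^sup>2) = s"
    unfolding s_def by (intro sum.cong) auto
  have "s\<^sup>2 \<le> s"
    using hyponormal_finite_support[OF H u F, of f] by (simp add: f_def[symmetric] 1 2) (simp add: f_def)
  moreover have "0 \<le> s"
    unfolding s_def by (intro sum_nonneg) simp
  ultimately show "s \<le> 1"
    by (cases "s = 0") (auto simp: power2_eq_square)
qed

text \<open>Cauchy-Schwarz with weight \<open>W\<close> bounds each coordinate of
  \<open>adj f\<close> by the part of the squared norm of \<open>S f\<close> carried by that fibre;
  summing over the fibres gives the norm inequality.\<close>

lemma hyponormalI:
  assumes nz: "\<And>v. v \<in> V \<Longrightarrow> l v \<noteq> 0 \<Longrightarrow> W v \<noteq> 0"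
    and le1: "\<And>u F. u \<in> V \<Longrightarrow> finite F \<Longrightarrow> F \<subseteq> fibre V p u \<Longrightarrow> (\<Sum>v\<in>F. (cmod (l v))\<^sup>2 / W v) \<le> 1"
  shows "hyponormal V S"
  unfolding hyponormal_iff_norm
proof
  fix f assume f: "f \<in> ell2 V"
  let ?w = "\<lambda>v. W v * (cmod (f v))\<^sup>2"
  have smV: "?w summable_on V"
    using S_norm[OF f] by (rule has_sum_imp_summable)
  have sm: "?w summable_on fibre V p u" for u
    by (rule summable_on_subset_banach[OF smV fibre_subset])
  have hs: "((\<lambda>u. \<Sum>\<^sub>\<infinity>v\<in>fibre V p u. ?w v) has_sum (ell2_norm V (S f))\<^sup>2) V"
  proof (rule has_sum_fibresD[where p = p and V = V])
    show "(?w has_sum (ell2_norm V (S f))\<^sup>2) {v \<in> V. p v \<in> V}"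
      unfolding preimage_V by (rule S_norm[OF f])
  qed (rule has_sum_infsum[OF sm])
  have le: "(cmod (adj f u))\<^sup>2 \<le> (\<Sum>\<^sub>\<infinity>v\<in>fibre V p u. ?w v)" if u: "u \<in> V" for u
  proof -
    have "(cmod (\<Sum>\<^sub>\<infinity>v\<in>fibre V p u. cnj (l v) * f v))\<^sup>2 \<le> 1 * (\<Sum>\<^sub>\<infinity>v\<in>fibre V p u. ?w v)"
    proof (rule weighted_Cauchy_Schwarz(2)[OF _ _ _ sm])
      show "W v \<noteq> 0" if "v \<in> fibre V p u" "cnj (l v) \<noteq> 0" for v
        using that nz fibre_subset by fastforce
    qed (use le1[OF u] in auto)
    then show ?thesis
      using u by (simp add: adj_def)
  qed
  have "((\<lambda>u. (cmod (adj f u))\<^sup>2) has_sum (ell2_norm V (adj f))\<^sup>2) V"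
    unfolding ell2_norm_sq by (intro has_sum_infsum ell2_summable adj_ell2 f)
  then have "(ell2_norm V (adj f))\<^sup>2 \<le> (ell2_norm V (S f))\<^sup>2"
    using hs le by (rule has_sum_mono)
  then show "ell2_norm V (adj f) \<le> ell2_norm V (S f)"
    by (simp add: power2_le_iff_abs_le)
qed

end

section \<open>Powers of weighted shifts\<close>

text \<open>For \<open>n = 0\<close> the two sides differ outside \<open>V\<close>, where only the
  right one is cut off to 0.\<close>

lemma weighted_shift_power:
  assumes p: "p \<in> V \<rightarrow> V" and n: "1 \<le> n"
  shows "weighted_shift V p l ^^ n = weighted_shift V (p ^^ n) (\<lambda>v. \<Prod>i<n. l ((p ^^ i) v))"
  using n
proof (induction n rule: dec_induct)
  case base
  show ?case
    by simp
next
  case (step n)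
  show ?case
  proof (intro ext)
    fix f v
    show "(weighted_shift V p l ^^ Suc n) f v
        = weighted_shift V (p ^^ Suc n) (\<lambda>v. \<Prod>i<Suc n. l ((p ^^ i) v)) f v"
      \<comment> \<open>The factor with index 0 is split off, so that the induction hypothesis
        applies at \<open>p v\<close>.\<close>
      using p unfolding prod.lessThan_Suc_shift
      by (auto simp: step.IH weighted_shift_def funpow_swap1 mult.assoc)
  qed
qed

lemma bounded_operator_compose:
  assumes S: "bounded_operator V S" and T: "bounded_operator V T"
  shows "bounded_operator V (S \<circ> T)"
proof -
  obtain C D where C: "\<And>f. f \<in> ell2 V \<Longrightarrow> ell2_norm V (S f) \<le> C * ell2_norm V f"
    and D: "\<And>f. f \<in> ell2 V \<Longrightarrow> ell2_norm V (T f) \<le> D * ell2_norm V f"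
    using S T unfolding bounded_operator_def by metis
  have T_in: "\<And>f. f \<in> ell2 V \<Longrightarrow> T f \<in> ell2 V"
    using T by (auto simp: bounded_operator_def)
  have "ell2_norm V (S (T f)) \<le> (\<bar>C\<bar> * D) * ell2_norm V f" if f: "f \<in> ell2 V" for f
  proof -
    have "ell2_norm V (S (T f)) \<le> C * ell2_norm V (T f)"
      by (rule C[OF T_in[OF f]])
    also have "\<dots> \<le> \<bar>C\<bar> * ell2_norm V (T f)"
      by (rule mult_right_mono) auto
    also have "\<dots> \<le> \<bar>C\<bar> * (D * ell2_norm V f)"
      by (rule mult_left_mono[OF D[OF f]]) simp
    finally show ?thesis
      by simp
  qed
  then have "\<exists>C. \<forall>f\<in>ell2 V. ell2_norm V ((S \<circ> T) f) \<le> C * ell2_norm V f"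
    by auto
  then show ?thesis
    using S T T_in unfolding bounded_operator_def by auto
qed

lemma bounded_operator_power:
  assumes "bounded_operator V T" "1 \<le> n"
  shows "bounded_operator V (T ^^ n)"
  using assms(2)
proof (induction n rule: dec_induct)
  case (step n)
  then show ?case
    by (simp only: funpow.simps(2) bounded_operator_compose[OF assms(1)])
qed (simp add: assms(1))

lemma funpow_in: "p \<in> V \<rightarrow> V \<Longrightarrow> v \<in> V \<Longrightarrow> (p ^^ n) v \<in> V"
  by (induction n) auto

lemma (in bounded_shift) bounded_shift_power:
  assumes "1 \<le> n"
  shows "bounded_shift V (p ^^ n) (\<lambda>v. \<Prod>i<n. l ((p ^^ i) v))"
proof
  show "p ^^ n \<in> V \<rightarrow> V"
    by (simp add: funpow_in p_in)
  show "bounded_operator V (weighted_shift V (p ^^ n) (\<lambda>v. \<Prod>i<n. l ((p ^^ i) v)))"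
    using bounded_operator_power[OF bounded assms] by (simp only: weighted_shift_power[OF p_in assms])
qed

text \<open>On a forkless forest the moduli of the weights of a hyponormal shift increase along every
  branch, so each quotient in the hyponormality criterion for the power is at most the
  corresponding quotient for the shift itself.\<close>

lemma forkless_power_hyponormal:
  assumes p: "p \<in> V \<rightarrow> V" and fork: "forkless V p" and ws: "weight_system V p l"
    and hyp: "hyponormal V (weighted_shift V p l)" and n: "1 \<le> n"
  shows "hyponormal V (weighted_shift V p l ^^ n)"
proof -
  interpret bounded_shift V p l
    by standard (use p hyp in \<open>auto simp: hyponormal_def\<close>)
  define N where "N = V - roots V p"
  have N: "v \<in> N \<longleftrightarrow> v \<in> V \<and> p v \<noteq> v" for v
    by (auto simp: N_def roots_def)
  have "\<exists>c. fibre V p v = {c}" if "v \<in> N" for v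
  proof -
    have "fibre V p v = Chi V p v"
      using that by (auto simp: N Chi_def fibre_def)
    then show ?thesis
      using fork that by (auto simp: forkless_def N_def card_1_singleton_iff)
  qed
  \<comment> \<open>\<open>c\<close> sends a non-root to its only child; it runs down each branch,
    inverting \<open>p\<close>.\<close>
  then obtain c where c: "\<And>v. v \<in> N \<Longrightarrow> fibre V p v = {c v}"
    by metis
  have pc: "p (c v) = v" and cN: "c v \<in> N" if "v \<in> N" for v
  proof -
    have "c v \<in> fibre V p v"
      using c[OF that] by simp
    then show "p (c v) = v" "c v \<in> N"
      using that by (auto simp: N fibre_def)
  qed
  have cnN: "(c ^^ i) x \<in> N" if "x \<in> N" for i x
    using that by (induction i) (auto intro: cN)
  have pcn: "(p ^^ i) ((c ^^ (i + j)) x) = (c ^^ j) x" if "x \<in> N" for i j x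
  proof (induction i)
    case (Suc i)
    then show ?case
      using pc[OF cnN[OF that, of "i + j"]] by (simp add: funpow_swap1)
  qed simp
  \<comment> \<open>If the ancestor \<open>i\<close> levels up is a non-root, then so are all
    vertices in between, and the way down from it is forced.\<close>
  have cpn: "v = (c ^^ i) ((p ^^ i) v)" if "v \<in> V" "(p ^^ i) v \<in> N" for i v
    using that
  proof (induction i arbitrary: v)
    case (Suc i)
    have "(p ^^ i) (p v) \<in> N"
      using Suc.prems by (simp add: funpow_swap1)
    with Suc have *: "p v = (c ^^ i) ((p ^^ i) (p v))"
      using p by blast
    then have "p v \<in> N"
      using cnN \<open>(p ^^ i) (p v) \<in> N\<close> by metis
    then have "v = c (p v)"
      using c[of "p v"] Suc.prems by (auto simp: fibre_def)
    with * show ?case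
      by (simp add: funpow_swap1)
  qed simp
  have cadd: "(c ^^ i) ((c ^^ j) x) = (c ^^ (i + j)) x" for i j x
    by (simp add: funpow_add)
  define m where "m v = (cmod (l v))\<^sup>2" for v
  have m0: "0 \<le> m v" for v
    by (simp add: m_def)
  have W: "W v = m (c v)" if "v \<in> N" for v
    using c[OF that] by (simp add: fibre_weight_def m_def)
  \<comment> \<open>This is the hyponormality criterion for the one-element set \<open>{v}\<close>,
    with \<open>W v = m (c v)\<close>.\<close>
  have mono1: "m v \<le> m (c v)" if v: "v \<in> N" for v
  proof (cases "l v = 0")
    case False
    have "(\<Sum>u\<in>{v}. (cmod (l u))\<^sup>2 / W u) \<le> 1"
      by (rule hyponormal_sum_le_1[OF hyp, of "p v"]) (use v p in \<open>auto simp: N fibre_def\<close>)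
    moreover have "W v \<noteq> 0"
      using hyponormal_weight_nonzero[OF hyp] v False by (auto simp: N)
    ultimately show ?thesis
      using W[OF v] m0[of "c v"] by (auto simp: m_def[symmetric] divide_simps split: if_splits)
  qed (simp add: m_def)
  have mono: "m ((c ^^ i) x) \<le> m ((c ^^ (j + i)) x)" if "x \<in> N" for i j x
  proof (induction j)
    case (Suc j)
    with mono1[OF cnN[OF that, of "j + i"]] show ?case
      by simp
  qed simp
  \<comment> \<open>The weight of the power at \<open>v\<close> involves \<open>v\<close> and its
    first \<open>k = n - 1\<close> ancestors, so vertices are parametrized by the topmost one,
    \<open>x = (p ^^ k) v\<close>.\<close>
  obtain k where k: "n = Suc k"
    using n by (cases n) auto
  define ln where "ln v = (\<Prod>i<n. l ((p ^^ i) v))" for v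
  define P where "P x = (\<Prod>i<n. m ((c ^^ i) x))" for x
  interpret pow: bounded_shift V "p ^^ n" ln
    unfolding ln_def by (rule bounded_shift_power[OF n])
  have ln: "(cmod (ln ((c ^^ k) x)))\<^sup>2 = P x" if x: "x \<in> N" for x
  proof -
    have "(cmod (ln ((c ^^ k) x)))\<^sup>2 = (\<Prod>i<n. m ((p ^^ i) ((c ^^ k) x)))"
      by (simp add: ln_def m_def prod_norm[symmetric] prod_power_distrib)
    also have "\<dots> = (\<Prod>i<n. m ((c ^^ (n - Suc i)) x))"
    proof (rule prod.cong)
      fix i assume "i \<in> {..<n}"
      then show "m ((p ^^ i) ((c ^^ k) x)) = m ((c ^^ (n - Suc i)) x)"
        using pcn[OF x, of i "k - i"] by (simp add: k)
    qed simp
    also have "\<dots> = P x"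
      unfolding P_def by (rule prod.nat_diff_reindex)
    finally show ?thesis .
  qed
  have Wn: "fibre_weight V (p ^^ n) ln ((c ^^ k) x) = P ((c ^^ n) x)" if x: "x \<in> N" for x
  proof -
    define v where "v = (c ^^ k) x"
    have v: "v \<in> N"
      unfolding v_def by (rule cnN[OF x])
    have "fibre V (p ^^ n) v = {(c ^^ n) v}"
      using cpn[of _ n] v pcn[OF v, of n 0] cnN[OF v, of n] by (auto simp: fibre_def N)
    moreover have "(c ^^ n) v = (c ^^ k) ((c ^^ n) x)"
      by (simp add: v_def cadd add.commute)
    ultimately show ?thesis
      using ln[OF cnN[OF x]] by (simp add: fibre_weight_def v_def)
  qed
  have Pnz: "P ((c ^^ n) x) \<noteq> 0" if x: "x \<in> N" and P: "P x \<noteq> 0" for x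
  proof -
    have "m ((c ^^ (i + n)) x) \<noteq> 0" if "i < n" for i
    proof -
      have "0 < m ((c ^^ i) x)"
        using P m0[of "(c ^^ i) x"] that by (auto simp: P_def less_le)
      also have "\<dots> \<le> m ((c ^^ (n + i)) x)"
        by (rule mono[OF x])
      finally show ?thesis
        by (simp add: add.commute)
    qed
    then show ?thesis
      by (simp add: P_def cadd)
  qed
  \<comment> \<open>By monotonicity every factor with positive index is at most 1, and in the
    remaining one \<open>m ((c ^^ n) x)\<close> may be lowered to \<open>m (c x)\<close>.\<close>
  have quot: "P x / P ((c ^^ n) x) \<le> m x / m (c x)" if x: "x \<in> N" for x
  proof -
    have "P x / P ((c ^^ n) x) = (\<Prod>i<n. m ((c ^^ i) x) / m ((c ^^ (n + i)) x))"
      by (simp add: P_def prod_dividef cadd add.commute)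
    also have "\<dots> = m x / m ((c ^^ n) x) * (\<Prod>i<k. m ((c ^^ Suc i) x) / m ((c ^^ (n + Suc i)) x))"
      unfolding k prod.lessThan_Suc_shift by simp
    also have "\<dots> \<le> m x / m ((c ^^ n) x) * 1"
    proof (intro mult_left_mono prod_le_1 conjI)
      fix i
      show "m ((c ^^ Suc i) x) / m ((c ^^ (n + Suc i)) x) \<le> 1"
        using mono[OF x, of "Suc i" n] m0 by (intro divide_le_eq_1[THEN iffD2]) (metis less_le)
    qed (simp_all add: m0)
    also have "\<dots> \<le> m x / m (c x)"
    proof (cases "m (c x) = 0")
      case True
      then have "m x = 0"
        using mono1[OF x] m0[of x] by simp
      then show ?thesis
        by simp
    next
      case False
      then have "0 < m (c x)"
        using m0[of "c x"] by simp
      moreover have "m (c x) \<le> m ((c ^^ n) x)"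
        using mono[OF x, of 1 k] by (simp add: k)
      ultimately show ?thesis
        using m0[of x] by (simp add: frac_le)
    qed
    finally show ?thesis .
  qed
  \<comment> \<open>The topmost factor of \<open>ln v\<close> is nonzero, whereas weights vanish at
    roots.\<close>
  have nonroot: "(p ^^ k) v \<in> N" if "v \<in> V" "ln v \<noteq> 0" for v
  proof -
    have "l ((p ^^ k) v) \<noteq> 0"
      using that by (auto simp: ln_def k)
    then show ?thesis
      using ws funpow_in[OF p that(1)] by (auto simp: N_def weight_system_def)
  qed
  have "hyponormal V (weighted_shift V (p ^^ n) ln)"
  proof (rule pow.hyponormalI)
    fix v assume v: "v \<in> V" "ln v \<noteq> 0"
    define x where "x = (p ^^ k) v"
    have x: "x \<in> N" "v = (c ^^ k) x"
      unfolding x_def using nonroot[OF v] cpn[OF v(1)] by auto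
    have "P x \<noteq> 0"
      unfolding ln[OF x(1), symmetric] using v(2) by (simp flip: x(2))
    then show "fibre_weight V (p ^^ n) ln v \<noteq> 0"
      unfolding x(2) Wn[OF x(1)] by (rule Pnz[OF x(1)])
  next
    fix u F assume u: "u \<in> V" and F: "finite F" "F \<subseteq> fibre V (p ^^ n) u"
    \<comment> \<open>On \<open>F'\<close> the map \<open>p ^^ k\<close> is injective with values in
      the children of \<open>u\<close>. As \<open>u\<close> may be a root with many children, the
      criterion for \<open>S\<close> is applied to the whole image.\<close>
    define F' where "F' = {v \<in> F. ln v \<noteq> 0}"
    let ?t = "\<lambda>v. (cmod (ln v))\<^sup>2 / fibre_weight V (p ^^ n) ln v"
    have F': "v \<in> V" "(p ^^ k) v \<in> N" "v = (c ^^ k) ((p ^^ k) v)" "p ((p ^^ k) v) = u" if "v \<in> F'" for v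
      using that F(2) nonroot cpn unfolding F'_def fibre_def k by auto
    have inj: "inj_on (p ^^ k) F'"
      by (rule inj_onI) (metis F'(3))
    have "sum ?t F = sum ?t F'"
      by (rule sum.mono_neutral_right) (use F in \<open>auto simp: F'_def\<close>)
    also have "\<dots> \<le> (\<Sum>v\<in>F'. (\<lambda>x. (cmod (l x))\<^sup>2 / W x) ((p ^^ k) v))"
    proof (rule sum_mono)
      fix v assume "v \<in> F'"
      note v = F'[OF this]
      show "?t v \<le> (cmod (l ((p ^^ k) v)))\<^sup>2 / W ((p ^^ k) v)"
        using quot[OF v(2)] ln[OF v(2)] Wn[OF v(2)] W[OF v(2)] by (simp add: v(3)[symmetric] m_def)
    qed
    also have "\<dots> = (\<Sum>x\<in>(p ^^ k) ` F'. (cmod (l x))\<^sup>2 / W x)"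
      by (subst sum.reindex[OF inj]) simp
    also have "\<dots> \<le> 1"
      by (rule hyponormal_sum_le_1[OF hyp u]) (use F(1) F' in \<open>auto simp: F'_def fibre_def N\<close>)
    finally show "sum ?t F \<le> 1" .
  qed
  then show ?thesis
    by (simp add: weighted_shift_power[OF p n] ln_def[abs_def])
qed

section \<open>A proper counterexample on forests with a fork\<close>

text \<open>Normalized geometric weights along an enumeration; strict positivity later makes the
  weights proper.\<close>

lemma countable_distribution:
  assumes A: "countable A" "A \<noteq> {}"
  obtains r :: "'a \<Rightarrow> real" where "\<And>v. v \<in> A \<Longrightarrow> 0 < r v" "(r has_sum 1) A"
proof -
  define g :: "'a \<Rightarrow> real" where "g v = (1 / 2) ^ to_nat_on A v" for v
  have "(\<lambda>n. (1 / 2 :: real) ^ n) summable_on UNIV"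
    by (rule summable_nonneg_imp_summable_on) (auto intro: summable_geometric)
  then have "(\<lambda>n. (1 / 2 :: real) ^ n) summable_on to_nat_on A ` A"
    by (rule summable_on_subset_banach) simp
  then have sm: "g summable_on A"
    using summable_on_reindex[OF inj_on_to_nat_on[OF A(1)], of "\<lambda>n. (1 / 2 :: real) ^ n"]
    by (simp add: o_def g_def[abs_def])
  obtain a where a: "a \<in> A"
    using A(2) by auto
  have "0 < g a"
    by (simp add: g_def)
  also have "g a \<le> infsum g A"
    using finite_sum_le_infsum[OF sm, of "{a}"] a by (simp add: g_def)
  finally have pos: "0 < infsum g A" .
  have "((\<lambda>v. g v * inverse (infsum g A)) has_sum infsum g A * inverse (infsum g A)) A"
    by (rule has_sum_cmult_left[OF has_sum_infsum[OF sm]])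
  then have "((\<lambda>v. g v * inverse (infsum g A)) has_sum 1) A"
    using pos by simp
  then show ?thesis
    using that[of "\<lambda>v. g v * inverse (infsum g A)"] pos by (simp add: g_def)
qed

text \<open>The mass 1/3 is reserved for \<open>x\<close>, and a distribution on the rest is scaled
  by 2/3.\<close>

lemma countable_distribution_third:
  assumes A: "countable A" "x \<in> A" "A \<noteq> {x}"
  obtains r :: "'a \<Rightarrow> real" where "\<And>v. v \<in> A \<Longrightarrow> 0 < r v" "(r has_sum 1) A" "r x = 1 / 3"
proof -
  have "countable (A - {x})" "A - {x} \<noteq> {}"
    using A by auto
  then obtain q :: "'a \<Rightarrow> real"
    where q: "\<And>v. v \<in> A - {x} \<Longrightarrow> 0 < q v" "(q has_sum 1) (A - {x})"
    by (rule countable_distribution) blast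
  define r where "r v = (if v = x then 1 / 3 else 2 / 3 * q v)" for v
  have "((\<lambda>v. 2 / 3 * q v) has_sum 2 / 3 * 1) (A - {x})"
    by (rule has_sum_cmult_right[OF q(2)])
  then have "(r has_sum 2 / 3 * 1) (A - {x})"
    by (rule has_sum_cong[THEN iffD1, rotated]) (auto simp: r_def)
  then have "(r has_sum r x + 2 / 3 * 1) (insert x (A - {x}))"
    by (intro has_sum_insert) auto
  then have "(r has_sum 1) A"
    using A(2) by (simp add: r_def insert_absorb)
  moreover have "0 < r v" if "v \<in> A" for v
    using q(1) that by (auto simp: r_def)
  ultimately show ?thesis
    using that[of r] by (simp add: r_def)
qed

lemma has_sum_point:
  fixes c :: "'b :: {comm_monoid_add, topological_space}"
  shows "x \<in> A \<Longrightarrow> ((\<lambda>v. if v = x then c else 0) has_sum c) A"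
  by (rule has_sum_finite_neutralI[of "{x}"]) auto

text \<open>Let \<open>w\<close> be a non-root with a child \<open>x\<close> that is not its only child. Choose the weights so that
  \<open>\<parallel>S e\<^sub>v\<parallel>\<^sup>2 = d v\<close> for every non-root \<open>v\<close>, where \<open>d\<close> is \<open>2\<close> on \<open>x\<close> and its descendants, \<open>4\<close> on the
  other proper descendants of \<open>w\<close>, and \<open>3\<close> elsewhere. The square mass \<open>d w = 3\<close> is distributed over
  the children of \<open>w\<close> as \<open>1\<close> for \<open>x\<close> and \<open>2\<close> for the others, so that the hyponormality criterion
  at \<open>w\<close> reads \<open>1/2 + 2/4 \<le> 1\<close>. For the square, the subtree at \<open>w\<close> contributes the factor
  \<open>3 (1/2\<^sup>2 + 2/4\<^sup>2) = 9/8\<close> to the criterion at \<open>p w\<close>, all siblings of \<open>w\<close> contribute the factor \<open>1\<close>,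
  and the sum exceeds \<open>1\<close>: the Cauchy--Schwarz inequality is strict because \<open>2 \<noteq> 4\<close>.\<close>

lemma non_forkless_counterexample:
  assumes forest: "directed_forest V p" and leafless: "leafless V p"
    and count: "locally_countable V p" and fork: "\<not> forkless V p"
  obtains l where "bounded_weighted_shift V p l" "proper_weights V p l"
    "hyponormal V (weighted_shift V p l)" "\<not> hyponormal V (weighted_shift V p l ^^ 2)"
proof -
  have p: "p \<in> V \<rightarrow> V" and cyc: "\<And>v n. v \<in> V \<Longrightarrow> (p ^^ Suc n) v = v \<Longrightarrow> p v = v"
    using forest unfolding directed_forest_def by (blast, metis le_add1 plus_1_eq_Suc)
  have pV: "p v \<in> V" if "v \<in> V" for v
    using p that by auto
  have child: "Chi V p v \<noteq> {}" if "v \<in> V" "p v \<noteq> v" for v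
  proof -
    obtain y where "y \<in> V" "p y = v"
      using leafless \<open>v \<in> V\<close> by (metis imageE leafless_def)
    then show ?thesis
      using that by (auto simp: Chi_def)
  qed
  obtain w where w: "w \<in> V" "p w \<noteq> w" and cardw: "card (Chi V p w) \<noteq> 1"
    using fork by (auto simp: forkless_def roots_def)
  obtain x where x: "x \<in> Chi V p w"
    using child[OF w] by blast
  have xV: "x \<in> V" and px: "p x = w"
    using x by (auto simp: Chi_def)
  have "\<exists>r. (\<forall>v\<in>Chi V p u. 0 < r v) \<and> (r has_sum (1 :: real)) (Chi V p u) \<and> (u = w \<longrightarrow> r x = 1 / 3)"
    if u: "u \<in> V" "Chi V p u \<noteq> {}" for u
  proof (cases "u = w")
    case True
    have "countable (Chi V p w)" "Chi V p w \<noteq> {x}"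
      using count w(1) cardw by (auto simp: locally_countable_def)
    then show ?thesis
      using countable_distribution_third[OF _ x] True by metis
  next
    case False
    have "countable (Chi V p u)"
      using count u(1) by (auto simp: locally_countable_def)
    then show ?thesis
      using countable_distribution[OF _ u(2)] False by metis
  qed
  then obtain Q where Q: "\<And>u v. u \<in> V \<Longrightarrow> Chi V p u \<noteq> {} \<Longrightarrow> v \<in> Chi V p u \<Longrightarrow> 0 < Q u v"
    "\<And>u. u \<in> V \<Longrightarrow> Chi V p u \<noteq> {} \<Longrightarrow> (Q u has_sum (1 :: real)) (Chi V p u)"
    "\<And>u. u \<in> V \<Longrightarrow> Chi V p u \<noteq> {} \<Longrightarrow> u = w \<Longrightarrow> Q u x = 1 / 3"
    by metis
  \<comment> \<open>The families \<open>Q u\<close> are glued into one function. The value 0 at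
    roots lets sums over fibres agree with sums over children.\<close>
  define q where "q v = (if p v = v then 0 else Q (p v) v)" for v
  have q_pos: "0 < q v" if "v \<in> V" "p v \<noteq> v" for v
  proof -
    have "v \<in> Chi V p (p v)"
      using that by (auto simp: Chi_def)
    then show ?thesis
      using Q(1)[OF pV] that by (auto simp: q_def)
  qed
  have q_nn: "0 \<le> q v" if "v \<in> V" for v
    using q_pos[OF that] by (cases "p v = v") (auto simp: q_def)
  have q_root: "q v = 0" if "p v = v" for v
    by (simp add: q_def that)
  have q_sum: "(q has_sum 1) (fibre V p u)" if "u \<in> V" "Chi V p u \<noteq> {}" for u
    by (rule has_sum_cong_neutral[THEN iffD1, OF _ _ _ Q(2)[OF that]])
       (auto simp: Chi_def fibre_def q_def)
  have q_sum0: "(q has_sum 0) (fibre V p u)" if "Chi V p u = {}" for u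
    by (rule has_sum_0) (use that in \<open>auto simp: Chi_def fibre_def q_def\<close>)
  have qx: "q x = 1 / 3"
    using Q(3)[OF w(1)] x px w by (auto simp: q_def)

  \<comment> \<open>Here \<open>n = 0\<close> is allowed, so \<open>x\<close> itself counts, while
    \<open>Suc n\<close> in \<open>D\<close> excludes \<open>w\<close>. Since \<open>Dx\<close>
    implies \<open>D\<close>, the definition of \<open>d\<close> must test \<open>Dx\<close>
    first.\<close>
  define Dx where "Dx v \<longleftrightarrow> (\<exists>n. (p ^^ n) v = x)" for v
  define D where "D v \<longleftrightarrow> (\<exists>n. (p ^^ Suc n) v = w)" for v
  define d :: "'a \<Rightarrow> real" where "d v = (if Dx v then 2 else if D v then 4 else 3)" for v
  have ex_Suc: "(\<exists>n. (p ^^ n) v = y) \<longleftrightarrow> v = y \<or> (\<exists>n. (p ^^ n) (p v) = y)" for v y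
  proof
    assume "\<exists>n. (p ^^ n) v = y"
    then obtain n where "(p ^^ n) v = y" ..
    then show "v = y \<or> (\<exists>n. (p ^^ n) (p v) = y)"
      by (cases n) (auto simp: funpow_swap1)
  next
    assume "v = y \<or> (\<exists>n. (p ^^ n) (p v) = y)"
    then show "\<exists>n. (p ^^ n) v = y"
      by (metis funpow_0 funpow_swap1 funpow.simps(2) comp_apply)
  qed
  have D_alt: "D v \<longleftrightarrow> (\<exists>n. (p ^^ n) (p v) = w)" for v
    by (simp add: D_def funpow_swap1)
  have Dx_step: "Dx v \<longleftrightarrow> v = x \<or> Dx (p v)" for v
    unfolding Dx_def by (rule ex_Suc)
  have D_step: "D v \<longleftrightarrow> p v = w \<or> D (p v)" for v
    unfolding D_alt by (rule ex_Suc)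
  have Dx_D: "D v" if "Dx v" for v
    using that px unfolding Dx_def D_def by auto
  \<comment> \<open>Otherwise the non-root \<open>w\<close> would lie on a cycle.\<close>
  have Dw: "\<not> D w"
    using cyc[OF w(1)] w(2) by (auto simp: D_def simp del: funpow.simps)
  then have Dpw: "\<not> D (p w)"
    using D_step[of w] by blast
  have dw: "d w = 3" and dpw: "d (p w) = 3"
    using Dw Dpw Dx_D by (auto simp: d_def)
  have d_step: "d v = d (p v)" if "p v \<noteq> w" for v
    using that Dx_step[of v] D_step[of v] px by (auto simp: d_def)
  have d_child: "d v = (if v = x then 2 else 4)" if "p v = w" for v
    using that Dx_step[of v] D_step[of v] Dx_D[of w] Dw by (auto simp: d_def)
  have d_bounds: "0 < d v" "d v \<le> 4" for v
    by (auto simp: d_def)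

  \<comment> \<open>Since \<open>q\<close> has mass 1 on each set of children, the fibre weight at
    \<open>u\<close> becomes \<open>d u\<close>.\<close>
  define m where "m v = q v * d (p v)" for v
  define l where "l v = complex_of_real (sqrt (m v))" for v
  have m_nn: "0 \<le> m v" if "v \<in> V" for v
    using q_nn[OF that] d_bounds(1)[of "p v"] by (simp add: m_def)
  have l_sq: "(cmod (l v))\<^sup>2 = m v" if "v \<in> V" for v
    using m_nn[OF that] by (simp add: l_def)
  have m_sum: "(m has_sum s * d u) (fibre V p u)" if "(q has_sum s) (fibre V p u)" for s u
    by (rule has_sum_cong[THEN iffD1, OF _ has_sum_cmult_left[OF that]])
       (auto simp: fibre_def m_def)
  have l_sum: "((\<lambda>v. (cmod (l v))\<^sup>2) has_sum s * d u) (fibre V p u)"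
    if "(q has_sum s) (fibre V p u)" for s u
    by (rule has_sum_cong[THEN iffD1, OF _ m_sum[OF that]]) (auto simp: fibre_def l_sq)
  have W: "fibre_weight V p l u = d u" if "u \<in> V" "Chi V p u \<noteq> {}" for u
    using l_sum[OF q_sum[OF that]] by (simp add: fibre_weight_def infsumI)
  \<comment> \<open>Only a root can be childless here, because it is its own preimage.\<close>
  have W0: "fibre_weight V p l u = 0" if "Chi V p u = {}" for u
    using l_sum[OF q_sum0[OF that]] by (simp add: fibre_weight_def infsumI)
  have bdd: "bounded_operator V (weighted_shift V p l)"
  proof (rule bounded_operator_weighted_shiftI[OF p])
    fix u assume u: "u \<in> V"
    show "(\<lambda>v. (cmod (l v))\<^sup>2) summable_on fibre V p u"
      using l_sum[OF q_sum[OF u]] l_sum[OF q_sum0] has_sum_imp_summable by metis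
    show "fibre_weight V p l u \<le> 4"
      using W[OF u] W0[of u] d_bounds(2)[of u] by (cases "Chi V p u = {}") auto
  qed
  interpret bounded_shift V p l
    by standard (use p bdd in auto)
  have l_zero: "l v = 0 \<longleftrightarrow> p v = v" if "v \<in> V" for v
    using q_pos[OF that] q_root[of v] d_bounds(1)[of "p v"]
    by (cases "p v = v") (simp_all add: l_def m_def)
  have proper: "proper_weights V p l"
    using l_zero by (auto simp: proper_weights_def roots_def)
  have bws: "bounded_weighted_shift V p l"
    using l_zero bdd S_ell2
    by (auto simp: bounded_weighted_shift_def weight_system_def roots_def weighted_shift_dom_def)
  have W_nonroot: "W v = d v" if "v \<in> V" "p v \<noteq> v" for v
    using W child that by blast

  have hyp: "hyponormal V S"
  proof (rule hyponormalI)
    fix v assume "v \<in> V" "l v \<noteq> 0"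
    then show "W v \<noteq> 0"
      using l_zero[of v] W_nonroot[of v] d_bounds(1)[of v] by auto
  next
    fix u F assume u: "u \<in> V" and F: "finite F" "F \<subseteq> fibre V p u"
    have FD: "v \<in> V" "p v = u" if "v \<in> F" for v
      using that F(2) by (auto simp: fibre_def)
    show "(\<Sum>v\<in>F. (cmod (l v))\<^sup>2 / W v) \<le> 1"
    proof (cases "u = w")
      \<comment> \<open>Away from \<open>w\<close>, \<open>d\<close> is constant from
        \<open>u\<close> to its children, so each quotient for a non-root is
        \<open>q v\<close>.\<close>
      case False
      obtain s where s: "(q has_sum s) (fibre V p u)" "s \<le> 1"
        using q_sum[OF u] q_sum0[of u] by (metis zero_le_one order_refl)
      have "(\<Sum>v\<in>F. (cmod (l v))\<^sup>2 / W v) = sum q F"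
      proof (rule sum.cong)
        fix v assume "v \<in> F"
        note v = FD[OF this]
        show "(cmod (l v))\<^sup>2 / W v = q v"
        proof (cases "p v = v")
          case nonroot: False
          then show ?thesis
            using l_sq[OF v(1)] W_nonroot[OF v(1)] d_step[of v] False v d_bounds(1)[of v]
            by (simp add: m_def)
        qed (use l_sq[OF v(1)] q_root[of v] in \<open>simp add: m_def\<close>)
      qed simp
      also have "\<dots> \<le> s"
        by (rule finite_sum_le_has_sum[OF s(1) F]) (auto simp: fibre_def q_nn)
      finally show ?thesis
        using s(2) by simp
    next
      case True
      \<comment> \<open>The quotient is \<open>3 * q v / d v\<close>: this is
        \<open>q v * (3 / 4)\<close> when \<open>d v = 4\<close>, and 1/2 at \<open>x\<close>, which
        exceeds \<open>q x * (3 / 4)\<close> by 1/4.\<close>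
      let ?h = "\<lambda>v. q v * (3 / 4) + (if v = x then 1 / 4 else 0)"
      have "(?h has_sum 1 * (3 / 4) + 1 / 4) (fibre V p w)"
        by (intro has_sum_add has_sum_cmult_left has_sum_point q_sum w(1) child w)
           (simp add: fibre_def xV px)
      then have hs: "(?h has_sum 1) (fibre V p w)"
        by simp
      have "(\<Sum>v\<in>F. (cmod (l v))\<^sup>2 / W v) = sum ?h F"
      proof (rule sum.cong)
        fix v assume "v \<in> F"
        note v = FD[OF this]
        have "p v \<noteq> v"
          using v True w by auto
        then show "(cmod (l v))\<^sup>2 / W v = ?h v"
          using l_sq[OF v(1)] W_nonroot[OF v(1)] d_child[of v] True v dw qx
          by (simp add: m_def)
      qed simp
      also have "\<dots> \<le> 1"
        by (rule finite_sum_le_has_sum[OF hs]) (use F True in \<open>auto simp: fibre_def q_nn\<close>)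
      finally show ?thesis .
    qed
  qed

  have "\<not> hyponormal V (S ^^ 2)"
  proof
    assume H: "hyponormal V (S ^^ 2)"
    define l2 where "l2 v = (\<Prod>i<2. l ((p ^^ i) v))" for v
    interpret pow: bounded_shift V "p ^^ 2" l2
      unfolding l2_def by (rule bounded_shift_power) simp
    have H2: "hyponormal V (weighted_shift V (p ^^ 2) l2)"
      using H weighted_shift_power[OF p, of 2 l] by (simp add: l2_def[abs_def])
    have l2_sq: "(cmod (l2 v))\<^sup>2 = m v * m (p v)" if "v \<in> V" for v
    proof -
      have "l2 v = l v * l (p v)"
        by (simp add: l2_def numeral_2_eq_2)
      then show ?thesis
        by (simp add: norm_mult power_mult_distrib l_sq that pV)
    qed
    have fibre2: "fibre V (p ^^ 2) u = {v \<in> V. p v \<in> fibre V p u}" for u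
      using pV by (auto simp: fibre_def numeral_2_eq_2)
    \<comment> \<open>As \<open>v\<close> is not \<open>w\<close>, its children \<open>y\<close>
      satisfy \<open>d y = d v\<close>, and two generations each contribute a factor
      \<open>d v\<close>.\<close>
    have W2: "pow.W v = d v * d v" if v: "v \<in> V" "p v \<noteq> v" "v \<noteq> w" for v
    proof -
      have "((\<lambda>y. (cmod (l2 y))\<^sup>2) has_sum d v * d v) {y \<in> V. p y \<in> fibre V p v}"
      proof (rule has_sum_fibresI)
        fix y assume "y \<in> fibre V p v"
        then have y: "y \<in> V" "p y = v" "p y \<noteq> y"
          using v by (auto simp: fibre_def)
        have "((\<lambda>z. m z * m y) has_sum 1 * d y * m y) (fibre V p y)"
          by (intro has_sum_cmult_left m_sum q_sum child y)
        moreover have "1 * d y * m y = m y * d v"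
          using d_step[of y] y v(3) by simp
        ultimately have "((\<lambda>z. m z * m y) has_sum m y * d v) (fibre V p y)"
          by metis
        then show "((\<lambda>z. (cmod (l2 z))\<^sup>2) has_sum m y * d v) (fibre V p y)"
          by (rule has_sum_cong[THEN iffD1, rotated]) (auto simp: l2_sq fibre_def)
      next
        have "((\<lambda>y. m y * d v) has_sum 1 * d v * d v) (fibre V p v)"
          by (intro has_sum_cmult_left m_sum q_sum child v)
        then show "((\<lambda>y. m y * d v) has_sum d v * d v) (fibre V p v)"
          by simp
      qed simp
      then show ?thesis
        by (simp add: fibre_weight_def fibre2 infsumI)
    qed
    \<comment> \<open>The terms of the criterion for the square at \<open>p w\<close> are grouped by
      the parent \<open>u\<close>: each group sums to \<open>q u\<close>, except that
      \<open>w\<close> gives \<open>9 / 8 * q w\<close>.\<close>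
    define t where "t v = (cmod (l2 v))\<^sup>2 / pow.W v" for v
    have "(t has_sum 1 + q w / 8) {v \<in> V. p v \<in> fibre V p (p w)}"
    proof (rule has_sum_fibresI)
      fix u assume "u \<in> fibre V p (p w)"
      then have u: "u \<in> V" "p u = p w"
        by (auto simp: fibre_def)
      show "(t has_sum q u + (if u = w then q w / 8 else 0)) (fibre V p u)"
      proof (cases "p u = u")
        \<comment> \<open>This is the root \<open>u = p w\<close> lying in its own fibre, where all
          terms vanish.\<close>
        case True
        have "(t has_sum 0) (fibre V p u)"
          by (rule has_sum_0) (use True q_root in \<open>auto simp: fibre_def t_def l2_sq m_def\<close>)
        then show ?thesis
          using True w q_root by auto
      next
        case False
        have v: "v \<in> V" "p v = u" "t v = m v * m u / (d v * d v)" if "v \<in> fibre V p u" for v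
        proof -
          show v: "v \<in> V" "p v = u"
            using that by (auto simp: fibre_def)
          have "p v \<noteq> v" "v \<noteq> w"
            using v u False w by auto
          then show "t v = m v * m u / (d v * d v)"
            using l2_sq[OF v(1)] W2[OF v(1)] v by (simp add: t_def)
        qed
        have mu: "m u = q u * 3"
          using u dpw by (simp add: m_def)
        show ?thesis
        proof (cases "u = w")
          case True
          \<comment> \<open>Here \<open>t v = 9 * q v * q w / (d v)\<^sup>2\<close>: the coefficient
            of \<open>q w\<close> is \<open>q v * (9 / 16)\<close> when \<open>d v = 4\<close>, and
            3/4 at \<open>x\<close>, which exceeds \<open>q x * (9 / 16)\<close> by 9/16.\<close>
          let ?h = "\<lambda>v. (q v * (9 / 16) + (if v = x then 9 / 16 else 0)) * q w"
          have "(?h has_sum (1 * (9 / 16) + 9 / 16) * q w) (fibre V p w)"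
            by (intro has_sum_add has_sum_cmult_left has_sum_point q_sum w(1) child w)
               (simp add: fibre_def xV px)
          moreover have "?h v = t v" if "v \<in> fibre V p w" for v
            using v[of v] that True d_child[of v] mu dw qx by (auto simp: m_def)
          ultimately have "(t has_sum (1 * (9 / 16) + 9 / 16) * q w) (fibre V p w)"
            using has_sum_cong[of "fibre V p w" ?h t] by blast
          then show ?thesis
            using True by simp
        next
          \<comment> \<open>At a sibling of \<open>w\<close> and its children \<open>d\<close> is
            constantly 3 and cancels.\<close>
          case ne: False
          have "p u \<noteq> w"
            using u w by simp
          then have du: "d u = 3"
            using d_step[of u] u dpw by simp
          have "((\<lambda>v. q v * q u) has_sum 1 * q u) (fibre V p u)"
            by (intro has_sum_cmult_left q_sum child u(1) False)
          moreover have "q v * q u = t v" if "v \<in> fibre V p u" for v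
          proof -
            have "m v = q v * 3" "d v = 3"
              using v[OF that] du d_step[of v] ne by (simp_all add: m_def)
            then show ?thesis
              using v(3)[OF that] mu by simp
          qed
          ultimately have "(t has_sum 1 * q u) (fibre V p u)"
            using has_sum_cong[of "fibre V p u" "\<lambda>v. q v * q u" t] by blast
          then show ?thesis
            using ne by simp
        qed
      qed
    next
      have "w \<in> Chi V p (p w)"
        using w by (auto simp: Chi_def)
      then show "((\<lambda>u. q u + (if u = w then q w / 8 else 0)) has_sum 1 + q w / 8) (fibre V p (p w))"
        by (intro has_sum_add q_sum has_sum_point pV w) (auto simp: fibre_def w)
    qed (simp add: t_def)
    moreover have "sum t F \<le> 1" if "finite F" "F \<subseteq> {v \<in> V. p v \<in> fibre V p (p w)}" for F
      unfolding t_def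
      by (rule pow.hyponormal_sum_le_1[OF H2 pV[OF w(1)]]) (use that fibre2 in auto)
    ultimately have "1 + q w / 8 \<le> 1"
      by (rule has_sum_le_finite_sums)
    then show False
      using q_pos[OF w] by simp
  qed
  with bws proper hyp show ?thesis
    by (rule that)
qed

section \<open>Equivalence of the conditions, for all weights and for proper weights\<close>

theorem theorem4p8:
  fixes V :: "'v set" and p :: "'v \<Rightarrow> 'v"
  assumes "directed_forest V p"
    and "leafless V p"
    and "locally_countable V p"
  shows
    "((\<forall>l. bounded_weighted_shift V p l \<and> hyponormal V (weighted_shift V p l) \<longrightarrow>
           power_hyponormal V (weighted_shift V p l))
      \<longleftrightarrow>
      (\<forall>l. bounded_weighted_shift V p l \<and> hyponormal V (weighted_shift V p l) \<longrightarrow>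
           hyponormal V (weighted_shift V p l ^^ 2)))
     \<and>
     ((\<forall>l. bounded_weighted_shift V p l \<and> hyponormal V (weighted_shift V p l) \<longrightarrow>
           hyponormal V (weighted_shift V p l ^^ 2))
      \<longleftrightarrow> forkless V p)
     \<and>
     ((\<forall>l. bounded_weighted_shift V p l \<and> proper_weights V p l \<and>
           hyponormal V (weighted_shift V p l) \<longrightarrow>
           power_hyponormal V (weighted_shift V p l))
      \<longleftrightarrow>
      (\<forall>l. bounded_weighted_shift V p l \<and> proper_weights V p l \<and>
           hyponormal V (weighted_shift V p l) \<longrightarrow>
           hyponormal V (weighted_shift V p l ^^ 2)))"
proof (cases "forkless V p")
  case True
  have "p \<in> V \<rightarrow> V"
    using assms(1) by (simp add: directed_forest_def)
  then have "power_hyponormal V (weighted_shift V p l)"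
    if "bounded_weighted_shift V p l" "hyponormal V (weighted_shift V p l)" for l
    using that True forkless_power_hyponormal
    unfolding power_hyponormal_def bounded_weighted_shift_def by blast
  moreover have "hyponormal V (weighted_shift V p l ^^ 2)"
    if "power_hyponormal V (weighted_shift V p l)" for l
    using that unfolding power_hyponormal_def by (meson one_le_numeral)
  ultimately show ?thesis
    using True by blast
next
  case False
  \<comment> \<open>A single proper \<open>l\<close> refutes both conditions, with and without the
    restriction to proper weights.\<close>
  then obtain l where l: "bounded_weighted_shift V p l" "proper_weights V p l"
    "hyponormal V (weighted_shift V p l)" "\<not> hyponormal V (weighted_shift V p l ^^ 2)"
    using non_forkless_counterexample[OF assms] by blast
  then have "\<not> power_hyponormal V (weighted_shift V p l)"
    unfolding power_hyponormal_def by (meson one_le_numeral)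
  with l False show ?thesis
    by blast
qed

end
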